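(* Let $A\in\mathbb R^{2n\times2n}$ be a symmetric positive definite matrix partitioned as $A=\begin{pmatrix}A_{11}&A_{12}\\ A_{12}^T&A_{22}\end{pmatrix}$ with $n\times n$ blocks. Let $$L_1=\begin{pmatrix}L_{11}&0\\ L_{21}&L_{11}^{-T}\end{pmatrix},\qquad L_2=\begin{pmatrix}L_{11}&0\\ L_{21}&U_{22}\end{pmatrix},$$ where $A_{11}=L_{11}L_{11}^T$ is the Cholesky factorization of $A_{11}$, $L_{21}=(L_{11}^{-1}A_{12})^T$, and $S=U_{22}U_{22}^T$ is the Reverse Cholesky factorization of the Schur complement $S=A_{22}-A_{12}^TA_{11}^{-1}A_{12}$. Then $$\|\Omega(L_1)\|_2\le\|A_{11}^{-1}\|_2\,\|\Omega(A)\|_2$$ and $$\|\Omega(L_1)\|_2\le\|\Omega(L_2)\|_2\le\|\Omega(L_1)\|_2+\|L_{11}^TU_{22}-I\|_2.$$ Moreover, if $$\rho\left(A_{11}(S-A_{11}^{-1})\right)\le\tfrac12,$$ then $$\|L_{11}^TU_{22}-I\|_2\le(2n)^{1/2}\,\rho\left(A_{11}(S-A_{11}^{-1})\right).$$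
   Context: For $X\in\mathbb R^{2n\times2n}$, $\Omega(X)=X^TJX-J$, where $J=\begin{pmatrix}0&I\\ -I&0\end{pmatrix}$ with $I$ the $n\times n$ identity. $\|\cdot\|_2$ is the spectral norm and $\rho$ is the spectral radius. The Cholesky factorization of a symmetric positive definite $M$ is $M=LL^T$ with $L$ lower triangular with positive diagonal entries; the Reverse Cholesky factorization is the unique decomposition $M=UU^T$ with $U$ upper triangular with positive diagonal entries. *)

theory Defs
  imports "HOL-Analysis.Analysis"
begin

text \<open>
  Square matrices of order \<open>n\<close> are indexed by a type \<open>'n\<close> with \<open>CARD('n) = n\<close>, and matrices of
  order \<open>2n\<close> by \<open>'n + 'n\<close>, where \<open>Inl\<close> indexes the first \<open>n\<close> rows (columns) and \<open>Inr\<close> the last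
  \<open>n\<close>. Triangularity refers to a linear order on the index type \<open>'n\<close>.
\<close>

definition block_matrix ::
  "'a^'m^'k \<Rightarrow> 'a^'n^'k \<Rightarrow> 'a^'m^'l \<Rightarrow> 'a^'n^'l \<Rightarrow> 'a^('m + 'n)^('k + 'l)" where
  "block_matrix A B C D =
     (\<chi> i j. case i of
        Inl r \<Rightarrow> (case j of Inl s \<Rightarrow> A $ r $ s | Inr s \<Rightarrow> B $ r $ s)
      | Inr r \<Rightarrow> (case j of Inl s \<Rightarrow> C $ r $ s | Inr s \<Rightarrow> D $ r $ s))"

definition J_matrix :: "real^('n::finite + 'n)^('n + 'n)" where
  "J_matrix = block_matrix 0 (mat 1) (- mat 1) 0"

definition Omega :: "real^('n::finite + 'n)^('n + 'n) \<Rightarrow> real^('n + 'n)^('n + 'n)" where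
  "Omega X = transpose X ** J_matrix ** X - J_matrix"

abbreviation spectral_norm :: "real^'n^'m \<Rightarrow> real" where
  "spectral_norm X \<equiv> onorm ((*v) X)"

definition eigenvalues :: "complex^'n^'n \<Rightarrow> complex set" where
  "eigenvalues M = {c. \<exists>v. v \<noteq> 0 \<and> M *v v = c *s v}"

text \<open>
  All complex eigenvalues of the real matrix are taken into account. There are finitely many of
  them and at least one, so the supremum is a maximum.
\<close>

definition spectral_radius :: "real^'n^'n \<Rightarrow> real" where
  "spectral_radius M = (SUP c\<in>eigenvalues (map_matrix complex_of_real M). cmod c)"

definition sym_pos_def :: "real^'n^'n \<Rightarrow> bool" where
  "sym_pos_def M \<longleftrightarrow> transpose M = M \<and> (\<forall>x. x \<noteq> 0 \<longrightarrow> x \<bullet> (M *v x) > 0)"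

definition lower_triangular ::
  "real^('n::{finite,linorder})^('n::{finite,linorder}) \<Rightarrow> bool" where
  "lower_triangular L \<longleftrightarrow> (\<forall>i j. i < j \<longrightarrow> L $ i $ j = 0)"

definition upper_triangular ::
  "real^('n::{finite,linorder})^('n::{finite,linorder}) \<Rightarrow> bool" where
  "upper_triangular U \<longleftrightarrow> (\<forall>i j. j < i \<longrightarrow> U $ i $ j = 0)"

definition Cholesky ::
  "real^('n::{finite,linorder})^('n::{finite,linorder}) \<Rightarrow> real^('n::{finite,linorder})^('n::{finite,linorder}) \<Rightarrow> bool" where
  "Cholesky M L \<longleftrightarrow> lower_triangular L \<and> (\<forall>i. L $ i $ i > 0) \<and> M = L ** transpose L"

definition reverse_Cholesky ::
  "real^('n::{finite,linorder})^('n::{finite,linorder}) \<Rightarrow> real^('n::{finite,linorder})^('n::{finite,linorder}) \<Rightarrow> bool" where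
  "reverse_Cholesky M U \<longleftrightarrow> upper_triangular U \<and> (\<forall>i. U $ i $ i > 0) \<and> M = U ** transpose U"

end

theory Submission
  imports Defs
begin

text \<open>
  Write \<open>L = L11\<close>. For a block lower triangular matrix with blocks \<open>L\<close>, \<open>L21\<close>, \<open>Y\<close> the residual
  \<open>Omega\<close> has the diagonal blocks \<open>W\<close>, \<open>0\<close> and the off-diagonal blocks \<open>E\<close>, \<open>- E\<^sup>T\<close>, where
  \<open>W = L\<^sup>T L21 - L21\<^sup>T L\<close> and \<open>E = L\<^sup>T Y - I\<close> (\<open>Omega_block_matrix\<close>). The choice \<open>Y = L\<^sup>-\<^sup>T\<close> makes
  \<open>E\<close> vanish, so the norm of \<open>Omega L1\<close> is the norm of \<open>W\<close>. Restricting to the block \<open>W\<close> of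
  \<open>Omega L2\<close>, and splitting \<open>Omega L2\<close> into its diagonal and antidiagonal parts, gives the
  two-sided bound. The upper left block of \<open>Omega A\<close> is \<open>L W L\<^sup>T\<close>, and the norm of \<open>L\<^sup>-\<^sup>1\<close> is at most the
  square root of the norm of \<open>L\<^sup>-\<^sup>T L\<^sup>-\<^sup>1 = A11\<^sup>-\<^sup>1\<close>; this gives the bound by the residual of \<open>A\<close>.

  For the last claim put \<open>T = L\<^sup>T U22\<close>. It is upper triangular with positive diagonal, and
  \<open>K = T T\<^sup>T - I = L\<^sup>T S L - I\<close> is similar to \<open>A11 (S - A11\<^sup>-\<^sup>1)\<close>. As \<open>K\<close> is symmetric, its norm is the
  modulus of an eigenvalue, hence at most the spectral radius
  (\<open>spectral_norm_le_spectral_radius_similar\<close>). What remains is a perturbation bound for triangular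
  factors: if the norm \<open>k\<close> of \<open>T T\<^sup>T - I\<close> is at most \<open>1 / 2\<close>, then \<open>T - I\<close> has norm at most
  \<open>sqrt (2 n) k\<close>.

  This bound is proved column by column. Truncate \<open>T\<close> to its leading block of order \<open>j\<close>. This
  block is the restriction of \<open>T\<close> to the span of the first \<open>j\<close> unit vectors, so its singular values
  lie between the extreme singular values of \<open>T\<close>, and its Gram matrix (block times transpose)
  still deviates from the identity by at most \<open>k\<close>; and, because \<open>T\<close> is triangular, the last column
  of this Gram matrix is \<open>t\<close> times column \<open>j\<close> of \<open>T\<close>, with \<open>t\<close> the diagonal entry. So the vector
  \<open>z = t T e\<^sub>j - e\<^sub>j\<close> has norm at most \<open>k\<close> (\<open>triangular_gram_column_deviation\<close>). Passing from \<open>z\<close> to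
  \<open>T e\<^sub>j - e\<^sub>j\<close> divides the entries off the diagonal by \<open>t\<close> and shrinks the diagonal one, and
  \<open>t\<^sup>2 \<ge> 1 / 2\<close>, so each column of \<open>T - I\<close> has norm at most \<open>sqrt 2 k\<close>; the \<open>n\<close> columns together
  contribute the factor \<open>sqrt n\<close> (\<open>triangular_factor_near_identity\<close>).
\<close>

section \<open>Transposes, differences and inverses of matrices\<close>

(* Products with a transposed matrix are to stay visible as such. *)
declare transpose_matrix_vector [simp del]

lemma transpose_diff: "transpose (A - B) = transpose A - transpose (B :: 'a::ab_group_add^'n^'m)"
  by (simp add: transpose_def vec_eq_iff)

lemma transpose_zero [simp]: "transpose (0 :: 'a::zero^'n^'m) = 0"
  by (simp add: transpose_def vec_eq_iff)

lemma matrix_diff_ldistrib: "A ** (B - C) = A ** B - A ** (C :: 'a::ring_1^'k^'n)"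
  by (simp add: vec_eq_iff matrix_matrix_mult_def right_diff_distrib sum_subtractf)

lemma matrix_diff_rdistrib: "(B - C) ** A = B ** A - C ** (A :: 'a::ring_1^'k^'n)"
  by (simp add: vec_eq_iff matrix_matrix_mult_def left_diff_distrib sum_subtractf)

lemma inner_matrix_transpose:
  fixes A :: "real^'n^'m"
  shows "x \<bullet> (A *v y) = (transpose A *v x) \<bullet> y"
  by (simp add: dot_lmul_matrix transpose_matrix_vector)

lemma matrix_inv_cancel:
  fixes L :: "real^'n^'n"
  assumes "invertible L"
  shows "L ** matrix_inv L = mat 1" "matrix_inv L ** L = mat 1"
    "transpose L ** transpose (matrix_inv L) = mat 1"
    "transpose (matrix_inv L) ** transpose L = mat 1"
proof -
  have "\<exists>B. L ** B = mat 1 \<and> B ** L = mat 1"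
    using assms by (simp add: invertible_def)
  then show *: "L ** matrix_inv L = mat 1" "matrix_inv L ** L = mat 1"
    unfolding matrix_inv_def by (metis (mono_tags, lifting) someI_ex)+
  show "transpose L ** transpose (matrix_inv L) = mat 1"
    "transpose (matrix_inv L) ** transpose L = mat 1"
    by (metis * matrix_transpose_mul transpose_mat)+
qed

lemma matrix_inv_eqI:
  fixes A B :: "real^'n^'n"
  assumes "A ** B = mat 1"
  shows "matrix_inv A = B"
proof -
  have "invertible A" using assms invertible_right_inverse by blast
  then have "matrix_inv A ** A = mat 1" by (rule matrix_inv_cancel)
  then show ?thesis by (metis assms matrix_mul_assoc matrix_mul_lid matrix_mul_rid)
qed

section \<open>The spectral norm\<close>

lemma spectral_norm_ge: "norm (M *v x) \<le> spectral_norm M * norm x" for M :: "real^'n^'m"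
  by (simp add: onorm)

lemma spectral_norm_nonneg: "0 \<le> spectral_norm M" for M :: "real^'n^'m"
  by (simp add: onorm_pos_le)

lemma spectral_norm_mult_le: "spectral_norm (A ** B) \<le> spectral_norm A * spectral_norm B"
  for A :: "real^'n^'m" and B :: "real^'k^'n"
proof -
  have "(*v) (A ** B) = (*v) A \<circ> (*v) B"
    by (auto simp: matrix_vector_mul_assoc)
  then show ?thesis by (metis onorm_compose matrix_vector_mul_bounded_linear)
qed

text \<open>
  With \<open>y = M\<^sup>T x\<close>, the Cauchy-Schwarz inequality applied to \<open>y \<bullet> y = x \<bullet> M y\<close> bounds the square
  of the norm of \<open>y\<close>, and one factor cancels.
\<close>

lemma spectral_norm_transpose_le: "spectral_norm (transpose M) \<le> spectral_norm M"
  for M :: "real^'n^'m"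
proof (rule onorm_le)
  fix x
  let ?y = "transpose M *v x"
  have "norm ?y ^ 2 = x \<bullet> (M *v ?y)"
    by (simp add: inner_matrix_transpose power2_norm_eq_inner)
  also have "\<dots> \<le> norm x * (spectral_norm M * norm ?y)"
    by (meson norm_cauchy_schwarz order_trans mult_left_mono spectral_norm_ge norm_ge_zero)
  finally show "norm ?y \<le> spectral_norm M * norm x"
    by (cases "norm ?y = 0") (auto simp: power2_eq_square mult_ac spectral_norm_nonneg
        intro: mult_left_le_imp_le[of "norm ?y"])
qed

text \<open>
  The squared norm of \<open>B x\<close> is the value \<open>x \<bullet> B\<^sup>T B x\<close> of a quadratic form.
\<close>

lemma spectral_norm_gram: "spectral_norm B ^ 2 \<le> spectral_norm (transpose B ** B)"
  for B :: "real^'n^'m"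
proof -
  have "spectral_norm B \<le> sqrt (spectral_norm (transpose B ** B))"
  proof (rule onorm_le)
    fix x
    have "norm (B *v x) ^ 2 = x \<bullet> ((transpose B ** B) *v x)"
      using inner_matrix_transpose[of x "transpose B" "B *v x"]
      by (simp add: power2_norm_eq_inner flip: matrix_vector_mul_assoc)
    also have "\<dots> \<le> norm x * (spectral_norm (transpose B ** B) * norm x)"
      by (meson norm_cauchy_schwarz order_trans mult_left_mono spectral_norm_ge norm_ge_zero)
    finally have "norm (B *v x) ^ 2 \<le> (sqrt (spectral_norm (transpose B ** B)) * norm x) ^ 2"
      by (simp add: power_mult_distrib spectral_norm_nonneg) (simp add: power2_eq_square mult_ac)
    then show "norm (B *v x) \<le> sqrt (spectral_norm (transpose B ** B)) * norm x"
      by (rule power2_le_imp_le) (simp add: spectral_norm_nonneg)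
  qed
  then show ?thesis
    by (metis power_mono real_sqrt_pow2 spectral_norm_nonneg)
qed

text \<open>
  The image of \<open>x\<close> is the combination of the columns with the entries of \<open>x\<close> as coefficients, and
  the sum of the absolute values of these entries is at most \<open>sqrt n\<close> times the Euclidean norm.
\<close>

lemma spectral_norm_le_columns:
  fixes E :: "real^'n^'m"
  assumes "\<And>j. norm (column j E) \<le> b"
  shows "spectral_norm E \<le> sqrt (real CARD('n)) * b"
proof (rule onorm_le)
  fix x :: "real^'n"
  have b: "0 \<le> b" using assms order_trans norm_ge_zero by blast
  have "(\<Sum>j\<in>UNIV. \<bar>x $ j\<bar> * 1) ^ 2 \<le> (\<Sum>j\<in>UNIV. \<bar>x $ j\<bar> ^ 2) * (\<Sum>j\<in>(UNIV :: 'n set). 1 ^ 2)"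
    by (rule Cauchy_Schwarz_ineq_sum)
  moreover have "norm x ^ 2 = (\<Sum>j\<in>UNIV. \<bar>x $ j\<bar> ^ 2)"
    unfolding power2_norm_eq_inner inner_vec_def by (simp add: power2_eq_square)
  ultimately have "(\<Sum>j\<in>UNIV. \<bar>x $ j\<bar>) ^ 2 \<le> (sqrt (real CARD('n)) * norm x) ^ 2"
    by (simp add: power_mult_distrib mult_ac)
  then have *: "(\<Sum>j\<in>UNIV. \<bar>x $ j\<bar>) \<le> sqrt (real CARD('n)) * norm x"
    by (rule power2_le_imp_le) simp
  have "norm (E *v x) \<le> (\<Sum>j\<in>UNIV. norm (x $ j *s column j E))"
    unfolding matrix_mult_sum by (rule norm_sum)
  also have "\<dots> \<le> (\<Sum>j\<in>UNIV. \<bar>x $ j\<bar> * b)"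
    by (intro sum_mono) (simp add: scalar_mult_eq_scaleR mult_left_mono assms)
  also have "\<dots> = (\<Sum>j\<in>UNIV. \<bar>x $ j\<bar>) * b"
    by (rule sum_distrib_right[symmetric])
  also have "\<dots> \<le> sqrt (real CARD('n)) * b * norm x"
    using mult_right_mono[OF * b] by (simp add: mult_ac)
  finally show "norm (E *v x) \<le> sqrt (real CARD('n)) * b * norm x" .
qed

section \<open>Block matrices and the symplectic residual\<close>

definition block_vec :: "'a^'m \<Rightarrow> 'a^'n \<Rightarrow> 'a^('m + 'n)" where
  "block_vec x y = (\<chi> i. case i of Inl r \<Rightarrow> x $ r | Inr r \<Rightarrow> y $ r)"

lemma sum_UNIV_Plus: "sum f (UNIV :: ('m::finite + 'n::finite) set) = (\<Sum>i\<in>UNIV. f (Inl i)) + (\<Sum>i\<in>UNIV. f (Inr i))"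
  using sum.Plus[of "UNIV :: 'm set" "UNIV :: 'n set" f] by simp

lemma block_vec_cases:
  obtains x y where "v = block_vec x y"
proof
  show "v = block_vec (\<chi> i. v $ Inl i) (\<chi> i. v $ Inr i)"
    by (simp add: block_vec_def vec_eq_iff split: sum.split)
qed

lemma norm_block_vec: "norm (block_vec x y) ^ 2 = norm x ^ 2 + norm y ^ 2"
  for x :: "real^'m" and y :: "real^'n"
  by (simp add: power2_norm_eq_inner inner_vec_def sum_UNIV_Plus block_vec_def)

lemma block_matrix_vector_mult:
  "block_matrix A B C D *v block_vec x y = block_vec (A *v x + B *v y) (C *v x + D *v y)"
  by (simp add: block_matrix_def block_vec_def matrix_vector_mult_def vec_eq_iff sum_UNIV_Plus
      split: sum.split)

lemma block_matrix_mult: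
  "block_matrix A B C D ** block_matrix A' B' C' D' =
   block_matrix (A ** A' + B ** C') (A ** B' + B ** D') (C ** A' + D ** C') (C ** B' + D ** D')"
  by (simp add: block_matrix_def matrix_matrix_mult_def vec_eq_iff sum_UNIV_Plus split: sum.split)

lemma transpose_block_matrix:
  "transpose (block_matrix A B C D) =
   block_matrix (transpose A) (transpose C) (transpose B) (transpose D)"
  by (simp add: block_matrix_def transpose_def vec_eq_iff split: sum.split)

lemma diff_block_matrix:
  "block_matrix A B C D - block_matrix A' B' C' D' =
   block_matrix (A - A') (B - B') (C - C') (D - D')"
  by (simp add: block_matrix_def vec_eq_iff split: sum.split)

lemma Omega_block_matrix:
  "Omega (block_matrix P Q R S) = block_matrix
    (transpose P ** R - transpose R ** P) (transpose P ** S - transpose R ** Q - mat 1)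
    (transpose Q ** R - transpose S ** P + mat 1) (transpose Q ** S - transpose S ** Q)"
proof -
  have neg: "M ** (- mat 1) = - M" for M :: "real^'n^'n"
    by (simp add: matrix_diff_ldistrib[of M 0 "mat 1", simplified])
  show ?thesis
    unfolding Omega_def J_matrix_def
    by (simp add: transpose_block_matrix block_matrix_mult diff_block_matrix neg
        minus_mult_left matrix_diff_rdistrib[of 0, simplified])
qed

text \<open>
  The block is seen by applying the matrix to vectors whose second half vanishes.
\<close>

lemma spectral_norm_block_11_le: "spectral_norm A \<le> spectral_norm (block_matrix A B C D)"
  for A :: "real^'m^'k" and D :: "real^'n^'l"
proof (rule onorm_le)
  fix x :: "real^'m"
  have "norm (A *v x) \<le> norm (block_vec (A *v x) (C *v x))"
    by (rule power2_le_imp_le) (simp_all add: norm_block_vec)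
  also have "\<dots> = norm (block_matrix A B C D *v block_vec x 0)"
    by (simp add: block_matrix_vector_mult)
  also have "\<dots> \<le> spectral_norm (block_matrix A B C D) * norm (block_vec x (0 :: real^'n))"
    by (rule spectral_norm_ge)
  also have "norm (block_vec x (0 :: real^'n)) = norm x"
    by (rule power2_eq_imp_eq) (simp_all add: norm_block_vec)
  finally show "norm (A *v x) \<le> spectral_norm (block_matrix A B C D) * norm x" .
qed

lemma spectral_norm_block_diagonal:
  "spectral_norm (block_matrix A 0 0 0 :: real^('m::finite + 'n::finite)^('k::finite + 'l::finite)) = spectral_norm A"
  for A :: "real^'m^'k"
proof (rule antisym)
  show "spectral_norm (block_matrix A 0 0 0 :: real^('m + 'n)^('k + 'l)) \<le> spectral_norm A"
  proof (rule onorm_le)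
    fix v :: "real^('m + 'n)"
    obtain x :: "real^'m" and y :: "real^'n" where v: "v = block_vec x y" by (rule block_vec_cases)
    have "norm ((block_matrix A 0 0 0 :: real^('m + 'n)^('k + 'l)) *v v) = norm (A *v x)"
      by (rule power2_eq_imp_eq) (simp_all add: v block_matrix_vector_mult norm_block_vec)
    also have "\<dots> \<le> spectral_norm A * norm x" by (rule spectral_norm_ge)
    also have "\<dots> \<le> spectral_norm A * norm v"
    proof (rule mult_left_mono)
      show "norm x \<le> norm v" by (rule power2_le_imp_le) (simp_all add: v norm_block_vec)
    qed (rule spectral_norm_nonneg)
    finally show "norm ((block_matrix A 0 0 0 :: real^('m + 'n)^('k + 'l)) *v v) \<le> spectral_norm A * norm v" .
  qed
qed (rule spectral_norm_block_11_le)

text \<open>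
  The two halves of a vector are exchanged and mapped by \<open>B\<close> and \<open>- B\<^sup>T\<close> separately, so the squared
  norms of the two images add up.
\<close>

lemma spectral_norm_block_antidiagonal_le:
  "spectral_norm (block_matrix 0 B (- transpose B) 0) \<le> spectral_norm B"
  for B :: "real^'n^'m"
proof (rule onorm_le)
  fix v :: "real^('m + 'n)"
  obtain x y where v: "v = block_vec x y" by (rule block_vec_cases)
  have "norm (transpose B *v x) \<le> spectral_norm B * norm x"
    by (meson order_trans mult_right_mono spectral_norm_ge norm_ge_zero spectral_norm_transpose_le)
  then have "norm (B *v y) ^ 2 + norm (- transpose B *v x) ^ 2
      \<le> (spectral_norm B * norm y) ^ 2 + (spectral_norm B * norm x) ^ 2"
    using matrix_vector_mult_diff_rdistrib[of 0 "transpose B" x]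
    by (intro add_mono power_mono spectral_norm_ge) auto
  then have "norm (block_matrix 0 B (- transpose B) 0 *v v) ^ 2 \<le> (spectral_norm B * norm v) ^ 2"
    by (simp add: v block_matrix_vector_mult power_mult_distrib norm_block_vec algebra_simps)
  then show "norm (block_matrix 0 B (- transpose B) 0 *v v) \<le> spectral_norm B * norm v"
    by (rule power2_le_imp_le) (simp add: spectral_norm_nonneg)
qed

section \<open>Symmetric matrices and the spectral radius\<close>

text \<open>
  For a symmetric matrix the quadratic form determines the bilinear form by polarization. In
  \<open>4 v \<bullet> M u = (u + v) \<bullet> M (u + v) - (u - v) \<bullet> M (u - v)\<close> take for \<open>u\<close> and \<open>v\<close> the vectors \<open>x\<close> and
  \<open>M x\<close> rescaled to a common length; the parallelogram law then turns the bound on the form into the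
  bound on \<open>M x\<close>.
\<close>

lemma symmetric_norm_le_of_form:
  fixes M :: "real^'n^'n"
  assumes sym: "transpose M = M"
    and form: "\<And>x. \<bar>x \<bullet> (M *v x)\<bar> \<le> c * norm x ^ 2"
  shows "norm (M *v x) \<le> c * norm x"
proof -
  define a b where "a = norm x" and "b = norm (M *v x)"
  show ?thesis
  proof (cases "b = 0")
    case True
    then show ?thesis using form[of x]
      by (cases "x = 0") (auto simp: b_def zero_le_mult_iff dest: order_trans[OF abs_ge_zero])
  next
    case False
    define u v where "u = b *\<^sub>R x" and "v = a *\<^sub>R (M *v x)"
    have "a > 0" "b > 0"
      using False by (auto simp: a_def b_def)
    have Mu: "u \<bullet> (M *v v) = v \<bullet> (M *v u)"
      using inner_matrix_transpose[of u M v] by (simp add: sym inner_commute)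
    have "4 * (v \<bullet> (M *v u)) = (u + v) \<bullet> (M *v (u + v)) - (u - v) \<bullet> (M *v (u - v))"
      by (simp add: algebra_simps inner_add_left inner_add_right inner_diff_left inner_diff_right Mu)
    also have "\<dots> \<le> c * norm (u + v) ^ 2 + c * norm (u - v) ^ 2"
      using form[of "u + v"] form[of "u - v"] by linarith
    also have "\<dots> = 2 * c * (norm u ^ 2 + norm v ^ 2)"
      unfolding power2_norm_eq_inner
      by (simp add: algebra_simps inner_add_left inner_add_right inner_diff_left inner_diff_right)
    also have "\<dots> = 4 * c * a ^ 2 * b ^ 2"
      by (simp add: u_def v_def a_def b_def power_mult_distrib algebra_simps)
    also have "v \<bullet> (M *v u) = a * b * b ^ 2"
      by (simp add: u_def v_def b_def matrix_vector_mult_scaleR power2_norm_eq_inner)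
    finally have "(a * b\<^sup>2) * b \<le> (a * b\<^sup>2) * (c * a)"
      by (simp add: power2_eq_square mult_ac)
    then show ?thesis
      using \<open>a > 0\<close> \<open>b > 0\<close> by (simp add: a_def b_def)
  qed
qed

text \<open>
  Let the unit vector \<open>v\<close> maximize the norm of \<open>M x\<close> on the sphere, and let \<open>m\<close> be the maximum.
  Then \<open>M (M v) = m\<^sup>2 v\<close>, since expanding the squared norm of the difference gives at most \<open>0\<close>.
  So \<open>(M - m) (M + m) v = 0\<close>, and either \<open>v\<close> is an eigenvector for \<open>- m\<close> or \<open>M v + m v\<close> is one
  for \<open>m\<close>.
\<close>

lemma symmetric_spectral_norm_eigenvalue:
  fixes M :: "real^'n^'n"
  assumes sym: "transpose M = M"
  obtains v l where "v \<noteq> 0" "M *v v = l *\<^sub>R v" "\<bar>l\<bar> = spectral_norm M"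
proof -
  have "\<exists>v\<in>sphere 0 1. \<forall>x\<in>sphere 0 1. norm (M *v x) \<le> norm (M *v v)"
    by (intro continuous_attains_sup continuous_intros linear_continuous_on) auto
  then obtain v where v: "norm v = 1" and max: "\<And>x. norm x = 1 \<Longrightarrow> norm (M *v x) \<le> norm (M *v v)"
    by auto
  define m where "m = norm (M *v v)"
  have bound: "norm (M *v x) \<le> m * norm x" for x
  proof (cases "x = 0")
    case False
    then show ?thesis
      using max[of "(1 / norm x) *\<^sub>R x"] by (simp add: m_def matrix_vector_mult_scaleR field_simps)
  qed auto
  have m: "m = spectral_norm M"
    using onorm_le[of "(*v) M" m] bound spectral_norm_ge[of M v] v by (simp add: m_def)
  define w where "w = M *v (M *v v) - m\<^sup>2 *\<^sub>R v"
  have "v \<bullet> (M *v (M *v v)) = m\<^sup>2"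
    using inner_matrix_transpose[of v M "M *v v"] by (simp add: sym m_def power2_norm_eq_inner)
  then have "norm w ^ 2 = norm (M *v (M *v v)) ^ 2 - (m * m) ^ 2"
    using v unfolding w_def power2_norm_eq_inner norm_eq_1
    by (simp add: inner_diff_left inner_diff_right inner_commute power2_eq_square)
  also have "\<dots> \<le> 0"
    using power_mono[OF bound[of "M *v v"], of 2] by (simp add: m_def)
  finally have "w = 0" by simp
  then have MMv: "M *v (M *v v) = (m * m) *\<^sub>R v"
    by (simp add: w_def power2_eq_square)
  show ?thesis
  proof (cases "M *v v + m *\<^sub>R v = 0")
    case True
    then have "M *v v = (- m) *\<^sub>R v"
      by (simp add: eq_neg_iff_add_eq_0)
    then show ?thesis
      using that[of v "- m"] v m spectral_norm_nonneg[of M] by force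
  next
    case False
    have "M *v (M *v v + m *\<^sub>R v) = m *\<^sub>R (M *v v + m *\<^sub>R v)"
      by (simp add: MMv matrix_vector_right_distrib matrix_vector_mult_scaleR scaleR_right_distrib add.commute)
    then show ?thesis
      using that[OF False, of m] m by (auto simp: spectral_norm_nonneg)
  qed
qed

text \<open>
  The operator norm bounds every eigenvalue. Boundedness is what makes the supremum in
  \<open>spectral_radius\<close> an upper bound for the moduli of the eigenvalues.
\<close>

lemma bdd_above_eigenvalues: "bdd_above (cmod ` eigenvalues M)" for M :: "complex^'n^'n"
proof (rule bdd_aboveI2)
  fix c assume "c \<in> eigenvalues M"
  then obtain v where v: "v \<noteq> 0" "M *v v = c *s v"
    by (auto simp: eigenvalues_def)
  have "norm (c *s v) = cmod c * norm v"
    by (simp add: norm_vec_def norm_mult L2_set_right_distrib)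
  moreover have "norm (M *v v) \<le> onorm ((*v) M) * norm v"
    by (simp add: onorm)
  ultimately show "cmod c \<le> onorm ((*v) M)"
    using v by simp
qed

lemma abs_eigenvalue_le_spectral_radius:
  fixes M :: "real^'n^'n"
  assumes "v \<noteq> 0" "M *v v = l *\<^sub>R v"
  shows "\<bar>l\<bar> \<le> spectral_radius M"
proof -
  let ?v = "\<chi> i. complex_of_real (v $ i)"
  have "map_matrix complex_of_real M *v ?v = complex_of_real l *s ?v"
    using assms(2) by (simp add: vec_eq_iff matrix_vector_mult_def flip: of_real_mult of_real_sum)
  moreover have "?v \<noteq> 0"
    using assms(1) by (simp add: vec_eq_iff)
  ultimately have "complex_of_real l \<in> eigenvalues (map_matrix complex_of_real M)"
    by (auto simp: eigenvalues_def)
  then have "cmod (complex_of_real l) \<le> spectral_radius M"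
    unfolding spectral_radius_def by (rule cSUP_upper[OF _ bdd_above_eigenvalues])
  then show ?thesis by simp
qed

lemma spectral_norm_le_spectral_radius_similar:
  fixes K P N :: "real^'n^'n"
  assumes sym: "transpose K = K" and P: "invertible P" and sim: "N ** P = P ** K"
  shows "spectral_norm K \<le> spectral_radius N"
proof -
  obtain v l where v: "v \<noteq> 0" "K *v v = l *\<^sub>R v" "\<bar>l\<bar> = spectral_norm K"
    using symmetric_spectral_norm_eigenvalue[OF sym] .
  have "N *v (P *v v) = l *\<^sub>R (P *v v)"
    by (metis matrix_vector_mul_assoc sim v(2) matrix_vector_mult_scaleR)
  moreover have "P *v v \<noteq> 0"
    using inj_matrix_vector_mult[OF P] v(1) by (metis injD matrix_vector_mult_0_right)
  ultimately show ?thesis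
    using abs_eigenvalue_le_spectral_radius v(3) by metis
qed

section \<open>Triangular matrices whose Gram matrix is close to the identity\<close>

lemma norm_transpose_deviation:
  fixes M :: "real^'n^'m"
  shows "norm (transpose M *v x) ^ 2 - norm x ^ 2 = x \<bullet> ((M ** transpose M - mat 1) *v x)"
  by (simp add: power2_norm_eq_inner inner_matrix_transpose[of x M] matrix_vector_mult_diff_rdistrib
      inner_diff_right flip: matrix_vector_mul_assoc)

text \<open>
  A square matrix and its transpose have the same singular values; these are the two resulting
  inequalities for the extreme ones, each obtained from a single Cauchy-Schwarz estimate. The lower
  bound needs \<open>c > 0\<close> and a square matrix: then \<open>T\<close> is surjective and \<open>y = T x\<close> for some \<open>x\<close>.
\<close>

lemma transpose_norm_bounds:
  fixes T :: "real^'n^'n"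
  assumes "0 < c"
    and lower: "\<And>x. c * norm x ^ 2 \<le> norm (T *v x) ^ 2"
    and upper: "\<And>x. norm (T *v x) ^ 2 \<le> C * norm x ^ 2"
  shows "c * norm y ^ 2 \<le> norm (transpose T *v y) ^ 2"
    and "norm (transpose T *v y) ^ 2 \<le> C * norm y ^ 2"
proof -
  let ?z = "transpose T *v y"
  have "x = 0" if "T *v x = 0" for x
    using lower[of x] that \<open>0 < c\<close> by (simp add: mult_le_0_iff)
  then have "\<exists>B. T ** B = mat 1"
    using matrix_left_invertible_ker matrix_left_right_inverse by blast
  then obtain x where x: "T *v x = y"
    using matrix_right_invertible_surjective by (metis surj_def)
  show "c * norm y ^ 2 \<le> norm ?z ^ 2"
  proof (cases "y = 0")
    case False
    have "norm y ^ 2 = ?z \<bullet> x"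
      by (simp add: power2_norm_eq_inner x flip: inner_matrix_transpose)
    also have "\<dots> \<le> norm ?z * norm x"
      by (rule norm_cauchy_schwarz)
    finally have "(norm y ^ 2) ^ 2 \<le> (norm ?z * norm x) ^ 2"
      by (rule power_mono) simp
    then have "c * (norm y ^ 2) ^ 2 \<le> norm ?z ^ 2 * (c * norm x ^ 2)"
      using \<open>0 < c\<close> by (simp add: power_mult_distrib mult_ac)
    also have "\<dots> \<le> norm ?z ^ 2 * norm y ^ 2"
      using lower[of x] by (intro mult_left_mono) (auto simp: x)
    finally show ?thesis
      using False by (simp add: power2_eq_square mult_ac)
  qed simp
  show "norm ?z ^ 2 \<le> C * norm y ^ 2"
  proof (cases "?z = 0")
    case True
    have "0 \<le> C * norm x ^ 2" using upper[of x] by (rule order_trans[rotated]) simp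
    then have "y = 0 \<or> 0 \<le> C"
      using x by (auto simp: zero_le_mult_iff)
    then show ?thesis by (auto simp: True)
  next
    case False
    have "norm ?z ^ 2 = y \<bullet> (T *v ?z)"
      by (simp add: power2_norm_eq_inner inner_matrix_transpose[of y])
    also have "\<dots> \<le> norm y * norm (T *v ?z)"
      by (rule norm_cauchy_schwarz)
    finally have "(norm ?z ^ 2) ^ 2 \<le> (norm y * norm (T *v ?z)) ^ 2"
      by (rule power_mono) simp
    also have "\<dots> \<le> norm y ^ 2 * (C * norm ?z ^ 2)"
      unfolding power_mult_distrib by (intro mult_left_mono upper) simp
    finally show ?thesis
      using False by (simp add: power2_eq_square mult_ac)
  qed
qed

lemma upper_triangular_mult:
  fixes A B :: "real^('n::{finite,linorder})^('n::{finite,linorder})"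
  assumes A: "upper_triangular A" and B: "upper_triangular B"
  shows "upper_triangular (A ** B)" and "(A ** B) $ i $ i = A $ i $ i * B $ i $ i"
proof -
  have zero: "A $ i $ k * B $ k $ j = 0" if "k < i \<or> j < k" for i j k
    using that A B by (auto simp: upper_triangular_def)
  show "upper_triangular (A ** B)"
    unfolding upper_triangular_def
  proof (intro allI impI)
    fix i j :: 'n assume "j < i"
    then have "A $ i $ k * B $ k $ j = 0" for k
      by (intro zero) (meson le_less_trans not_le)
    then show "(A ** B) $ i $ j = 0"
      unfolding matrix_matrix_mult_def vec_lambda_beta by (intro sum.neutral ballI)
  qed
  have "(\<Sum>k\<in>UNIV. A $ i $ k * B $ k $ i) = (\<Sum>k\<in>{i}. A $ i $ k * B $ k $ i)"
  proof (rule sum.mono_neutral_right)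
    show "\<forall>k\<in>UNIV - {i}. A $ i $ k * B $ k $ i = 0"
      using zero neq_iff by blast
  qed auto
  then show "(A ** B) $ i $ i = A $ i $ i * B $ i $ i"
    by (simp add: matrix_matrix_mult_def)
qed

text \<open>
  Column \<open>j\<close> of \<open>T T\<^sup>T\<close> itself involves the later columns of \<open>T\<close>. They are removed by replacing \<open>T\<close> with
  the matrix \<open>R\<close> that agrees with it on the leading block up to index \<open>j\<close> and with the identity
  elsewhere: \<open>R\<^sup>T e\<^sub>j = t e\<^sub>j\<close>, where \<open>t\<close> is the \<open>j\<close>-th diagonal entry of \<open>T\<close>, and hence
  \<open>R R\<^sup>T e\<^sub>j = t T e\<^sub>j\<close>. That \<open>R R\<^sup>T\<close> is as close to the identity as \<open>T T\<^sup>T\<close> is seen through \<open>T\<close> and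
  \<open>R\<close> rather than through their transposes, because \<open>T\<close>, being upper triangular, maps vectors
  supported on the indices up to \<open>j\<close> to such vectors.
\<close>

lemma triangular_gram_column_deviation:
  fixes T :: "real^('n::{finite,linorder})^('n::{finite,linorder})"
  assumes T: "upper_triangular T"
    and k: "0 \<le> k" "k < 1"
    and dev: "\<And>x. norm ((T ** transpose T - mat 1) *v x) \<le> k * norm x"
  shows "norm (T $ j $ j *\<^sub>R column j T - axis j 1) \<le> k"
proof -
  define R where "R = (\<chi> i l. if i \<le> j \<and> l \<le> j then T $ i $ l else if i = l then 1 else 0)"
  have Tt: "\<bar>norm (transpose T *v x) ^ 2 - norm x ^ 2\<bar> \<le> k * norm x ^ 2" for x
  proof -
    have "\<bar>x \<bullet> ((T ** transpose T - mat 1) *v x)\<bar> \<le> norm x * (k * norm x)"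
      by (meson Cauchy_Schwarz_ineq2 dev mult_left_mono norm_ge_zero order_trans)
    also have "\<dots> = k * norm x ^ 2"
      by (simp add: power2_eq_square)
    finally show ?thesis
      unfolding norm_transpose_deviation .
  qed
  have "(1 - k) * norm x ^ 2 \<le> norm (transpose T *v x) ^ 2"
    and "norm (transpose T *v x) ^ 2 \<le> (1 + k) * norm x ^ 2" for x
    using Tt[of x] by (auto simp: algebra_simps abs_le_iff)
  note T_bounds = transpose_norm_bounds[of "1 - k" "transpose T" "1 + k", OF _ this, simplified, OF k(2)]
  have R_bounds: "(1 - k) * norm x ^ 2 \<le> norm (R *v x) ^ 2"
    "norm (R *v x) ^ 2 \<le> (1 + k) * norm x ^ 2" for x
  proof -
    \<comment> \<open>Split \<open>x\<close> into its leading part \<open>y\<close> and the rest \<open>w\<close>; \<open>R\<close> acts as \<open>T\<close> on \<open>y\<close>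
        and fixes \<open>w\<close>, and both \<open>T y\<close> and \<open>y\<close> are orthogonal to \<open>w\<close>.\<close>
    define y w where "y = (\<chi> i. if i \<le> j then x $ i else 0)" and "w = x - y"
    have Ty: "(T *v y) $ i = 0" if "\<not> i \<le> j" for i
    proof -
      have "T $ i $ l * y $ l = 0" for l
        using T that by (auto simp: upper_triangular_def y_def)
      then show ?thesis
        by (auto simp: matrix_vector_mult_def intro!: sum.neutral)
    qed
    have "R *v x = T *v y + w"
      unfolding vec_eq_iff
    proof
      fix i
      show "(R *v x) $ i = (T *v y + w) $ i"
      proof (cases "i \<le> j")
        case True
        then show ?thesis
          by (auto simp: R_def y_def w_def matrix_vector_mult_def intro!: sum.cong)
      next
        case False
        then have "(R *v x) $ i = x $ i"
          by (simp add: R_def matrix_vector_mult_def if_distrib[of "\<lambda>u. u * _"] cong: if_cong)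
        then show ?thesis
          using False Ty[OF False] by (simp add: y_def w_def)
      qed
    qed
    moreover have "orthogonal (T *v y) w"
    proof -
      have "(T *v y) $ i * w $ i = 0" for i
        using Ty[of i] by (cases "i \<le> j") (simp_all add: w_def y_def)
      then show ?thesis
        by (auto simp: orthogonal_def inner_vec_def intro!: sum.neutral)
    qed
    ultimately have 1: "norm (R *v x) ^ 2 = norm (T *v y) ^ 2 + norm w ^ 2"
      by (simp add: norm_add_Pythagorean)
    have "orthogonal y w"
      by (auto simp: orthogonal_def inner_vec_def y_def w_def intro!: sum.neutral)
    then have 2: "norm x ^ 2 = norm y ^ 2 + norm w ^ 2"
      using norm_add_Pythagorean[of y w] by (simp add: w_def)
    have "0 \<le> k * norm w ^ 2" using k by simp
    then show "(1 - k) * norm x ^ 2 \<le> norm (R *v x) ^ 2" "norm (R *v x) ^ 2 \<le> (1 + k) * norm x ^ 2"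
      using T_bounds[of y] unfolding 1 2 by (auto simp: algebra_simps)
  qed
  have "norm ((R ** transpose R - mat 1) *v axis j 1) \<le> k * norm (axis j (1::real))"
  proof (rule symmetric_norm_le_of_form)
    show "transpose (R ** transpose R - mat 1) = R ** transpose R - mat 1"
      by (simp add: transpose_diff matrix_transpose_mul)
    show "\<bar>x \<bullet> ((R ** transpose R - mat 1) *v x)\<bar> \<le> k * norm x ^ 2" for x
      using transpose_norm_bounds[OF _ R_bounds, of x] k
      unfolding norm_transpose_deviation[symmetric] by (simp add: algebra_simps abs_le_iff)
  qed
  also have "(R ** transpose R - mat 1) *v axis j 1 = T $ j $ j *\<^sub>R column j T - axis j 1"
  proof -
    have "transpose R *v axis j 1 = T $ j $ j *\<^sub>R axis j 1"
      unfolding matrix_vector_mult_basis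
      using T by (auto simp: column_def transpose_def R_def vec_eq_iff axis_def upper_triangular_def)
    moreover have "column j R = column j T"
      using T by (auto simp: column_def R_def vec_eq_iff upper_triangular_def)
    moreover have "(R ** transpose R - mat 1) *v axis j 1 = R *v (transpose R *v axis j 1) - axis j 1"
      by (simp only: matrix_vector_mult_diff_rdistrib matrix_vector_mul_assoc matrix_vector_mul_lid)
    ultimately show ?thesis
      by (simp only: matrix_vector_mult_scaleR matrix_vector_mult_basis)
  qed
  finally show ?thesis by simp
qed

text \<open>
  The vector \<open>z = t T e\<^sub>j - e\<^sub>j\<close> dominates \<open>c = T e\<^sub>j - e\<^sub>j\<close> entrywise up to the factor \<open>sqrt 2\<close>. Off the
  diagonal \<open>z = t c\<close>, and \<open>t\<^sup>2 = 1 + z\<^sub>j \<ge> 1 / 2\<close> because \<open>z\<close> has norm at most \<open>1 / 2\<close>. On the diagonal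
  \<open>t\<^sup>2 - 1 = (t - 1) (t + 1)\<close> with \<open>t > 0\<close>.
\<close>

lemma triangular_factor_near_identity:
  fixes T :: "real^('n::{finite,linorder})^('n::{finite,linorder})"
  assumes T: "upper_triangular T" and pos: "\<And>i. T $ i $ i > 0"
    and small: "spectral_norm (T ** transpose T - mat 1) \<le> 1 / 2"
  shows "spectral_norm (T - mat 1) \<le> sqrt (2 * real CARD('n)) * spectral_norm (T ** transpose T - mat 1)"
proof -
  define k where "k = spectral_norm (T ** transpose T - mat 1)"
  have "norm (column j (T - mat 1)) \<le> sqrt 2 * k" for j
  proof -
    define z c t where "z = T $ j $ j *\<^sub>R column j T - axis j 1"
      and "c = column j (T - mat 1)" and "t = T $ j $ j"
    have z: "norm z \<le> k"
      unfolding z_def k_def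
      by (rule triangular_gram_column_deviation[OF T])
        (use small in \<open>auto intro: spectral_norm_nonneg spectral_norm_ge\<close>)
    have t: "t > 0" by (simp add: t_def pos)
    have zj: "z $ j = t\<^sup>2 - 1"
      by (simp add: z_def t_def column_def power2_eq_square)
    have "\<bar>z $ j\<bar> \<le> 1 / 2"
      using component_le_norm_cart[of z j] z small by (simp add: k_def)
    then have t2: "1 \<le> 2 * t\<^sup>2" using zj by linarith
    have "(c $ i) ^ 2 \<le> 2 * (z $ i) ^ 2" for i
    proof (cases "i = j")
      case True
      have "(t - 1)\<^sup>2 * 1 \<le> (t - 1)\<^sup>2 * (t + 1)\<^sup>2"
        using t by (intro mult_left_mono one_le_power) auto
      also have "\<dots> = (z $ i)\<^sup>2"
        by (simp add: True zj power2_eq_square algebra_simps)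
      finally have "(t - 1)\<^sup>2 \<le> 2 * (z $ i)\<^sup>2"
        using zero_le_power2[of "z $ i"] by linarith
      then show ?thesis
        using True by (simp add: c_def column_def mat_def t_def)
    next
      case False
      then have "c $ i = T $ i $ j" "z $ i = t * T $ i $ j"
        by (auto simp: c_def z_def t_def column_def mat_def axis_def)
      then show ?thesis
        using mult_right_mono[OF t2, of "(T $ i $ j)\<^sup>2"] by (simp add: power_mult_distrib)
    qed
    then have "\<bar>c $ i\<bar> \<le> \<bar>(sqrt 2 *\<^sub>R z) $ i\<bar>" for i
      using real_sqrt_le_mono[of "(c $ i)\<^sup>2" "2 * (z $ i)\<^sup>2"]
      by (simp add: real_sqrt_mult abs_mult)
    then have "norm c \<le> norm (sqrt 2 *\<^sub>R z)"
      by (intro norm_le_componentwise_cart) simp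
    also have "\<dots> \<le> sqrt 2 * k"
      using z by simp
    finally show ?thesis
      by (simp add: c_def)
  qed
  then have "spectral_norm (T - mat 1) \<le> sqrt (real CARD('n)) * (sqrt 2 * k)"
    by (rule spectral_norm_le_columns)
  then show ?thesis
    by (simp add: k_def real_sqrt_mult mult_ac)
qed

section \<open>The residuals of the two factors\<close>

theorem theorem2p9:
  fixes A L1 L2 :: "real^('n::{finite,linorder} + 'n)^('n + 'n)"
    and A11 A12 A22 L11 L21 U22 S :: "real^('n::{finite,linorder})^('n::{finite,linorder})"
  assumes spd: "sym_pos_def A"
    and A_blocks: "A = block_matrix A11 A12 (transpose A12) A22"
    and chol: "Cholesky A11 L11"
    and L21: "L21 = transpose (matrix_inv L11 ** A12)"
    and S: "S = A22 - transpose A12 ** matrix_inv A11 ** A12"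
    and rchol: "reverse_Cholesky S U22"
    and L1: "L1 = block_matrix L11 0 L21 (transpose (matrix_inv L11))"
    and L2: "L2 = block_matrix L11 0 L21 U22"
  shows "spectral_norm (Omega L1) \<le> spectral_norm (matrix_inv A11) * spectral_norm (Omega A)
    \<and> spectral_norm (Omega L1) \<le> spectral_norm (Omega L2)
    \<and> spectral_norm (Omega L2)
        \<le> spectral_norm (Omega L1) + spectral_norm (transpose L11 ** U22 - mat 1)
    \<and> (spectral_radius (A11 ** (S - matrix_inv A11)) \<le> 1 / 2 \<longrightarrow>
        spectral_norm (transpose L11 ** U22 - mat 1)
          \<le> sqrt (2 * real CARD('n)) * spectral_radius (A11 ** (S - matrix_inv A11)))"
proof -
  define W where "W = transpose L11 ** L21 - transpose L21 ** L11"
  define T where "T = transpose L11 ** U22"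
  define Li where "Li = matrix_inv L11"

  have A11: "A11 = L11 ** transpose L11"
    using chol by (simp add: Cholesky_def)
  \<comment> \<open>The form of \<open>A\<close> on vectors \<open>(x, 0)\<close> is \<open>x \<bullet> A11 x\<close>, so \<open>L11\<^sup>T x = 0\<close> only for \<open>x = 0\<close>.\<close>
  have inv: "invertible L11"
  proof -
    have "x = 0" if "transpose L11 *v x = 0" for x
    proof (rule ccontr)
      assume "x \<noteq> 0"
      then have "norm (block_vec x (0 :: (real, 'n) vec)) ^ 2 \<noteq> 0"
        unfolding norm_block_vec by simp
      then have "block_vec x (0 :: (real, 'n) vec) \<noteq> 0"
        by auto
      then have "0 < block_vec x 0 \<bullet> (A *v block_vec x 0)"
        using spd by (simp add: sym_pos_def_def)
      also have "\<dots> = x \<bullet> (A11 *v x)"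
        by (simp add: A_blocks block_matrix_vector_mult)
          (simp add: block_vec_def inner_vec_def sum_UNIV_Plus)
      also have "\<dots> = 0"
        by (simp add: A11 that flip: matrix_vector_mul_assoc)
      finally show False by simp
    qed
    then have "invertible (transpose L11)"
      by (simp add: invertible_left_inverse matrix_left_invertible_ker)
    then show ?thesis
      using transpose_invertible by fastforce
  qed
  note Li = matrix_inv_cancel[OF inv, folded Li_def]
  have cancel: "L11 ** (Li ** M) = M" "Li ** (L11 ** M) = M"
    "transpose L11 ** (transpose Li ** M) = M" "transpose Li ** (transpose L11 ** M) = M"
    for M
    by (simp_all add: matrix_mul_assoc Li)
  have A11_inv: "matrix_inv A11 = transpose Li ** Li"
    by (rule matrix_inv_eqI) (simp add: A11 cancel Li flip: matrix_mul_assoc)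

  have Omega_L1: "Omega L1 = block_matrix W 0 0 0"
    by (simp add: L1 Omega_block_matrix W_def Li flip: Li_def)
  have Omega_L2: "Omega L2 = block_matrix W (T - mat 1) (- transpose (T - mat 1)) 0"
    by (simp add: L2 Omega_block_matrix W_def T_def transpose_diff matrix_transpose_mul)
  have norm_L1: "spectral_norm (Omega L1) = spectral_norm W"
    unfolding Omega_L1 by (rule spectral_norm_block_diagonal)

  have part1: "spectral_norm W \<le> spectral_norm (matrix_inv A11) * spectral_norm (Omega A)"
  proof -
    define G where "G = A11 ** transpose A12 - A12 ** A11"
    have "transpose A11 = A11"
      by (simp add: A11 matrix_transpose_mul)
    then have "spectral_norm G \<le> spectral_norm (Omega A)"
      unfolding A_blocks Omega_block_matrix G_def transpose_transpose
      using spectral_norm_block_11_le by metis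
    have "A12 = L11 ** transpose L21"
      by (simp add: L21 cancel flip: Li_def)
    then have "G = L11 ** W ** transpose L11"
      by (simp add: G_def W_def A11 matrix_transpose_mul matrix_diff_ldistrib matrix_diff_rdistrib
          matrix_mul_assoc)
    then have "W = Li ** (G ** transpose Li)"
      by (simp add: cancel Li flip: matrix_mul_assoc)
    then have "spectral_norm W \<le> spectral_norm Li * spectral_norm (G ** transpose Li)"
      by (simp only: spectral_norm_mult_le)
    also have "\<dots> \<le> spectral_norm Li * (spectral_norm G * spectral_norm (transpose Li))"
      by (intro mult_left_mono spectral_norm_mult_le spectral_norm_nonneg)
    also have "\<dots> \<le> spectral_norm Li * (spectral_norm (Omega A) * spectral_norm Li)"
      by (intro mult_left_mono mult_mono spectral_norm_nonneg spectral_norm_transpose_le) fact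
    also have "\<dots> = spectral_norm Li ^ 2 * spectral_norm (Omega A)"
      by (simp add: power2_eq_square mult_ac)
    also have "\<dots> \<le> spectral_norm (matrix_inv A11) * spectral_norm (Omega A)"
      unfolding A11_inv by (intro mult_right_mono spectral_norm_gram spectral_norm_nonneg)
    finally show ?thesis .
  qed

  have part2: "spectral_norm W \<le> spectral_norm (Omega L2)"
    unfolding Omega_L2 by (rule spectral_norm_block_11_le)

  have part3: "spectral_norm (Omega L2) \<le> spectral_norm W + spectral_norm (T - mat 1)"
  proof -
    let ?D = "block_matrix W 0 0 0 :: real^('n + 'n)^('n + 'n)"
    let ?F = "block_matrix 0 (T - mat 1) (- transpose (T - mat 1)) 0"
    have "(*v) (Omega L2) = (\<lambda>x. ?D *v x + ?F *v x)"
    proof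
      fix v :: "real^('n + 'n)"
      obtain x y where v: "v = block_vec x y" by (rule block_vec_cases)
      show "Omega L2 *v v = ?D *v v + ?F *v v"
        unfolding Omega_L2 v block_matrix_vector_mult
        by (simp add: block_vec_def vec_eq_iff split: sum.split)
    qed
    then have "spectral_norm (Omega L2) \<le> spectral_norm ?D + spectral_norm ?F"
      by (simp add: onorm_triangle)
    then show ?thesis
      using spectral_norm_block_antidiagonal_le[of "T - mat 1"]
      by (simp add: spectral_norm_block_diagonal)
  qed

  define r where "r = spectral_radius (A11 ** (S - matrix_inv A11))"
  have part4: "spectral_norm (T - mat 1) \<le> sqrt (2 * real CARD('n)) * r" if "r \<le> 1 / 2"
  proof -
    define K where "K = T ** transpose T - mat 1"
    have "S = U22 ** transpose U22"
      using rchol by (simp add: reverse_Cholesky_def)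
    then have "A11 ** (S - matrix_inv A11) ** L11 = L11 ** K"
      unfolding A11_inv
      by (simp add: K_def T_def A11 matrix_transpose_mul matrix_diff_ldistrib
          matrix_diff_rdistrib cancel Li flip: matrix_mul_assoc)
    then have K: "spectral_norm K \<le> r"
      unfolding r_def
      by (intro spectral_norm_le_spectral_radius_similar[OF _ inv])
        (simp_all add: K_def transpose_diff matrix_transpose_mul)
    have U22: "upper_triangular U22" "\<And>i. U22 $ i $ i > 0"
      using rchol by (auto simp: reverse_Cholesky_def)
    have L11: "upper_triangular (transpose L11)" "\<And>i. L11 $ i $ i > 0"
      using chol by (auto simp: Cholesky_def lower_triangular_def upper_triangular_def transpose_def)
    have "upper_triangular T" "\<And>i. T $ i $ i > 0"
      using upper_triangular_mult[OF L11(1) U22(1)] U22(2) L11(2)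
      by (simp_all add: T_def) (simp add: transpose_def)
    then have "spectral_norm (T - mat 1) \<le> sqrt (2 * real CARD('n)) * spectral_norm K"
      unfolding K_def using K that by (intro triangular_factor_near_identity) (auto simp: K_def)
    also have "\<dots> \<le> sqrt (2 * real CARD('n)) * r"
      using K by (intro mult_left_mono) auto
    finally show ?thesis .
  qed
  show ?thesis
    using part1 part2 part3 part4 unfolding norm_L1 T_def r_def by blast
qed

end
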